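(* Let $\{N_k\}_{k\ge1}$ be a countable set of nearly free $\mathbb Z$-modules. Then $\prod_{k=1}^{\infty}N_k$ is also nearly free.
   Context: A $\mathbb Z$-module $M$ is nearly free if every countable submodule of $M$ is $\mathbb Z$-free. *)

theory Defs
  imports "HOL-Algebra.Module" "HOL-Algebra.IntRing" "HOL-Library.Countable_Set"
begin

definition linearly_independent ::
    "('r, 'x) ring_scheme \<Rightarrow> ('r, 'a, 'm) module_scheme \<Rightarrow> 'a set \<Rightarrow> bool" where
  "linearly_independent R M B \<longleftrightarrow> B \<subseteq> carrier M \<and>
     (\<forall>A c. finite A \<and> A \<subseteq> B \<and> c \<in> A \<rightarrow> carrier R \<and>
        (\<Oplus>\<^bsub>M\<^esub>b\<in>A. c b \<odot>\<^bsub>M\<^esub> b) = \<zero>\<^bsub>M\<^esub> \<longrightarrow> (\<forall>b\<in>A. c b = \<zero>\<^bsub>R\<^esub>))"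

definition generates_module ::
    "('r, 'x) ring_scheme \<Rightarrow> ('r, 'a, 'm) module_scheme \<Rightarrow> 'a set \<Rightarrow> bool" where
  "generates_module R M B \<longleftrightarrow> B \<subseteq> carrier M \<and>
     (\<forall>x\<in>carrier M. \<exists>A c. finite A \<and> A \<subseteq> B \<and> c \<in> A \<rightarrow> carrier R \<and>
        x = (\<Oplus>\<^bsub>M\<^esub>b\<in>A. c b \<odot>\<^bsub>M\<^esub> b))"

definition free_module :: "('r, 'x) ring_scheme \<Rightarrow> ('r, 'a, 'm) module_scheme \<Rightarrow> bool" where
  "free_module R M \<longleftrightarrow> module R M \<and>
     (\<exists>B. linearly_independent R M B \<and> generates_module R M B)"

(* HOL's countable includes the finite sets. *)
definition nearly_free :: "(int, 'a, 'm) module_scheme \<Rightarrow> bool" where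
  "nearly_free M \<longleftrightarrow> module \<Z> M \<and>
     (\<forall>H. submodule H \<Z> M \<and> countable H \<longrightarrow> free_module \<Z> (M\<lparr>carrier := H\<rparr>))"

(* The module record extends the ring record; its fields mult and one play no role
   for modules and are filled in componentwise. *)
definition product_module ::
    "'i set \<Rightarrow> ('i \<Rightarrow> ('r, 'a, 'm) module_scheme) \<Rightarrow> ('r, 'i \<Rightarrow> 'a) module" where
  "product_module I N =
     \<lparr>carrier = (\<Pi>\<^sub>E i\<in>I. carrier (N i)),
      monoid.mult = (\<lambda>x y. \<lambda>i\<in>I. x i \<otimes>\<^bsub>N i\<^esub> y i),
      one = (\<lambda>i\<in>I. \<one>\<^bsub>N i\<^esub>),
      zero = (\<lambda>i\<in>I. \<zero>\<^bsub>N i\<^esub>),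
      add = (\<lambda>x y. \<lambda>i\<in>I. x i \<oplus>\<^bsub>N i\<^esub> y i),
      smult = (\<lambda>r x. \<lambda>i\<in>I. r \<odot>\<^bsub>N i\<^esub> x i)\<rparr>"

end

theory Submission
  imports Defs
begin

text \<open>
  The bridge is the notion of a torsionless module: one whose nonzero elements are
  detected by homomorphisms to the integers. Free modules are torsionless, by their coordinate
  functions (\<open>free_imp_torsionless\<close>), and a submodule \<open>H\<close> of a product inherits the property
  from the projections of \<open>H\<close> to the factors: a nonzero element has a nonzero coordinate, and
  a functional on the image of \<open>H\<close> there can be pulled back. When \<open>H\<close> is countable and the
  factors are nearly free, these images are countable submodules of the factors, hence free.
  So everything rests on the converse for countable modules, a form of Specker's theorem on
  countable subgroups of products of copies of the integers: a countable torsionless module is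
  free (\<open>countable_torsionless_imp_free\<close>).

  For this, let \<open>X'\<close> denote the double annihilator of \<open>X\<close>, the common zeros of all functionals
  that vanish on \<open>X\<close>. It replaces the pure closure of the span of \<open>X\<close> that occurs in
  Pontryagin's criterion, and makes rank arguments unnecessary. Suppose \<open>f\<close> vanishes on \<open>X\<close>
  but not at \<open>h\<close>, and put \<open>Q = (insert h X)'\<close>. If \<open>g\<close> also vanishes on \<open>X\<close>, then
  \<open>f h * g - g h * f\<close> vanishes on \<open>insert h X\<close>, hence on \<open>Q\<close>; so on the kernel of \<open>f\<close>
  in \<open>Q\<close> every such \<open>g\<close> is zero, and this kernel is just \<open>X'\<close>. As \<open>f\<close> maps \<open>Q\<close> onto
  an ideal generated by some \<open>f b\<close>, the module \<open>Q\<close> is the direct sum of \<open>X'\<close> and the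
  multiples of \<open>b\<close>. Adding the elements of an enumeration one at a time therefore starts at
  zero (the double annihilator of the empty set in a torsionless module), grows by at most one
  infinite cyclic summand in each step, and exhausts the module; the elements \<open>b\<close> form a basis.
\<close>

section \<open>Integral functionals\<close>

locale int_module = module \<Z> M for M :: "(int, 'a, 'm) module_scheme" (structure)

definition functional :: "(int, 'a, 'm) module_scheme \<Rightarrow> ('a \<Rightarrow> int) \<Rightarrow> bool" where
  "functional M f \<longleftrightarrow>
     (\<forall>x\<in>carrier M. \<forall>y\<in>carrier M. f (x \<oplus>\<^bsub>M\<^esub> y) = f x + f y) \<and>
     (\<forall>k. \<forall>x\<in>carrier M. f (k \<odot>\<^bsub>M\<^esub> x) = k * f x)"

definition torsionless :: "(int, 'a, 'm) module_scheme \<Rightarrow> bool" where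
  "torsionless M \<longleftrightarrow> (\<forall>x\<in>carrier M. x \<noteq> \<zero>\<^bsub>M\<^esub> \<longrightarrow> (\<exists>f. functional M f \<and> f x \<noteq> 0))"

lemma functional_add:
  "functional M f \<Longrightarrow> x \<in> carrier M \<Longrightarrow> y \<in> carrier M \<Longrightarrow> f (x \<oplus>\<^bsub>M\<^esub> y) = f x + f y"
  by (simp add: functional_def)

lemma functional_smult:
  "functional M f \<Longrightarrow> x \<in> carrier M \<Longrightarrow> f (k \<odot>\<^bsub>M\<^esub> x) = k * f x"
  by (simp add: functional_def)

lemma functional_combination:
  assumes "functional M f" "functional M g"
  shows "functional M (\<lambda>x. k * f x + l * g x)"
  using assms by (simp add: functional_def algebra_simps)

context int_module
begin

lemma smult_in_carrier: "x \<in> carrier M \<Longrightarrow> k \<odot> x \<in> carrier M"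
  by (rule smult_closed) simp_all

lemma functional_zero: "functional M f \<Longrightarrow> f \<zero> = 0"
  using functional_smult[of M f "\<zero>" 0] smult_l_null[of "\<zero>"] by simp

lemma functional_finsum:
  assumes f: "functional M f" and "finite A" "A \<subseteq> carrier M"
  shows "f (\<Oplus>b\<in>A. c b \<odot> b) = (\<Sum>b\<in>A. c b * f b)"
  using assms(2,3)
proof (induction A rule: finite_induct)
  case empty
  then show ?case using functional_zero[OF f] by simp
next
  case (insert b A)
  have "(\<lambda>a. c a \<odot> a) \<in> A \<rightarrow> carrier M"
    using insert.prems smult_in_carrier by blast
  moreover have "c b \<odot> b \<in> carrier M" "b \<in> carrier M"
    using insert.prems smult_in_carrier by auto
  ultimately show ?case
    using insert by (simp add: M.finsum_insert functional_add[OF f] functional_smult[OF f]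
        M.finsum_closed)
qed

end

section \<open>Linear combinations and coordinates\<close>

text \<open>
  Coefficient families are total functions that vanish outside a finite subset of \<open>B\<close>, so that
  they can be added and compared without reference to the finite set over which one sums.
\<close>

definition lincomb :: "(int, 'a, 'm) module_scheme \<Rightarrow> 'a set \<Rightarrow> ('a \<Rightarrow> int) \<Rightarrow> 'a \<Rightarrow> bool" where
  "lincomb M B c x \<longleftrightarrow> (\<exists>A. finite A \<and> A \<subseteq> B \<and> (\<forall>b. b \<notin> A \<longrightarrow> c b = 0) \<and>
     x = (\<Oplus>\<^bsub>M\<^esub>b\<in>A. c b \<odot>\<^bsub>M\<^esub> b))"

context int_module
begin

lemma smult_maps_to_carrier: "A \<subseteq> carrier M \<Longrightarrow> (\<lambda>b. c b \<odot> b) \<in> A \<rightarrow> carrier M"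
  using smult_in_carrier by blast

lemma finsum_enlarge:
  assumes "finite A'" "A \<subseteq> A'" "A' \<subseteq> carrier M" "\<forall>b. b \<notin> A \<longrightarrow> c b = 0"
  shows "(\<Oplus>b\<in>A. c b \<odot> b) = (\<Oplus>b\<in>A'. c b \<odot> b)"
proof (rule M.add.finprod_mono_neutral_cong_left)
  show "c b \<odot> b = \<zero>" if "b \<in> A' - A" for b
  proof -
    have "b \<in> carrier M" "c b = 0" using that assms by auto
    then show ?thesis using smult_l_null[of b] by simp
  qed
qed (use assms smult_maps_to_carrier in auto)

lemma lincomb_carrier:
  assumes "lincomb M B c x" "B \<subseteq> carrier M"
  shows "x \<in> carrier M"
proof -
  obtain A where "A \<subseteq> B" "x = (\<Oplus>b\<in>A. c b \<odot> b)"
    using assms(1) by (auto simp: lincomb_def)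
  then show ?thesis
    using M.finsum_closed[OF smult_maps_to_carrier[of A c]] assms(2) by simp
qed

lemma lincomb_add:
  assumes "B \<subseteq> carrier M" "lincomb M B c x" "lincomb M B d y"
  shows "lincomb M B (\<lambda>b. c b + d b) (x \<oplus> y)"
proof -
  obtain A where A: "finite A" "A \<subseteq> B" "\<forall>b. b \<notin> A \<longrightarrow> c b = 0" "x = (\<Oplus>b\<in>A. c b \<odot> b)"
    using assms by (auto simp: lincomb_def)
  obtain A' where A': "finite A'" "A' \<subseteq> B" "\<forall>b. b \<notin> A' \<longrightarrow> d b = 0"
    "y = (\<Oplus>b\<in>A'. d b \<odot> b)"
    using assms by (auto simp: lincomb_def)
  let ?U = "A \<union> A'"
  have U: "finite ?U" "?U \<subseteq> carrier M" using A A' assms(1) by auto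
  have "x = (\<Oplus>b\<in>?U. c b \<odot> b)" "y = (\<Oplus>b\<in>?U. d b \<odot> b)"
    using finsum_enlarge[of ?U A c] finsum_enlarge[of ?U A' d] U A A' by auto
  then have "x \<oplus> y = (\<Oplus>b\<in>?U. c b \<odot> b \<oplus> d b \<odot> b)"
    using U by (simp add: M.finsum_addf smult_maps_to_carrier)
  also have "\<dots> = (\<Oplus>b\<in>?U. (c b + d b) \<odot> b)"
  proof (rule M.finsum_cong')
    show "c b \<odot> b \<oplus> d b \<odot> b = (c b + d b) \<odot> b" if "b \<in> ?U" for b
      using smult_l_distr[of "c b" "d b" b] that U by auto
  qed (use U smult_maps_to_carrier in auto)
  finally show ?thesis
    unfolding lincomb_def using A A' U by (intro exI[of _ ?U]) auto
qed

lemma lincomb_smult: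
  assumes "B \<subseteq> carrier M" "lincomb M B c x"
  shows "lincomb M B (\<lambda>b. k * c b) (k \<odot> x)"
proof -
  obtain A where A: "finite A" "A \<subseteq> B" "\<forall>b. b \<notin> A \<longrightarrow> c b = 0" "x = (\<Oplus>b\<in>A. c b \<odot> b)"
    using assms by (auto simp: lincomb_def)
  have Ac: "A \<subseteq> carrier M" using A assms by auto
  have "k \<odot> x = (\<Oplus>b\<in>A. k \<odot> (c b \<odot> b))"
    using finsum_smult_ldistr[of A k "\<lambda>b. c b \<odot> b"] A Ac smult_maps_to_carrier by simp
  also have "\<dots> = (\<Oplus>b\<in>A. (k * c b) \<odot> b)"
  proof (rule M.finsum_cong')
    show "k \<odot> (c b \<odot> b) = (k * c b) \<odot> b" if "b \<in> A" for b
      using smult_assoc1[of k "c b" b] that Ac by auto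
  qed (use Ac smult_maps_to_carrier in auto)
  finally show ?thesis
    unfolding lincomb_def using A by (intro exI[of _ A]) auto
qed

lemma lincomb_zero: "lincomb M B (\<lambda>b. 0) \<zero>"
  unfolding lincomb_def by (intro exI[of _ "{}"]) simp

lemma lincomb_basis_element:
  assumes "b \<in> B" "b \<in> carrier M"
  shows "lincomb M B (\<lambda>a. if a = b then 1 else 0) b"
  unfolding lincomb_def
  by (intro exI[of _ "{b}"])
     (use assms smult_one[of b] in \<open>auto simp: M.finsum_insert\<close>)

lemma generates_module_iff_lincomb:
  "generates_module \<Z> M B \<longleftrightarrow> B \<subseteq> carrier M \<and> (\<forall>x\<in>carrier M. \<exists>c. lincomb M B c x)"
proof
  assume gen: "generates_module \<Z> M B"
  then have B: "B \<subseteq> carrier M" by (simp add: generates_module_def)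
  have "\<exists>c. lincomb M B c x" if x: "x \<in> carrier M" for x
  proof -
    obtain A c where A: "finite A" "A \<subseteq> B" "x = (\<Oplus>b\<in>A. c b \<odot> b)"
      using gen x unfolding generates_module_def by blast
    let ?c = "\<lambda>b. if b \<in> A then c b else 0"
    have "(\<Oplus>b\<in>A. c b \<odot> b) = (\<Oplus>b\<in>A. ?c b \<odot> b)"
      by (rule M.finsum_cong') (use A B smult_in_carrier in auto)
    then show ?thesis
      unfolding lincomb_def using A by (intro exI[of _ ?c] exI[of _ A]) auto
  qed
  with B show "B \<subseteq> carrier M \<and> (\<forall>x\<in>carrier M. \<exists>c. lincomb M B c x)" by blast
next
  assume "B \<subseteq> carrier M \<and> (\<forall>x\<in>carrier M. \<exists>c. lincomb M B c x)"
  then have B: "B \<subseteq> carrier M" and ex: "\<And>x. x \<in> carrier M \<Longrightarrow> \<exists>c. lincomb M B c x" by auto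
  have "\<exists>A c. finite A \<and> A \<subseteq> B \<and> c \<in> A \<rightarrow> carrier \<Z> \<and> x = (\<Oplus>b\<in>A. c b \<odot> b)"
    if x: "x \<in> carrier M" for x
  proof -
    obtain c A where "finite A" "A \<subseteq> B" "x = (\<Oplus>b\<in>A. c b \<odot> b)"
      using ex[OF x] unfolding lincomb_def by blast
    then show ?thesis by (intro exI[of _ A] exI[of _ c]) simp
  qed
  with B show "generates_module \<Z> M B"
    unfolding generates_module_def by blast
qed

text \<open>
  The difference of two coefficient families for the same element represents zero.
\<close>

lemma lincomb_unique:
  assumes ind: "linearly_independent \<Z> M B"
    and c: "lincomb M B c x" and d: "lincomb M B d x"
  shows "c = d"
proof
  fix b
  have B: "B \<subseteq> carrier M" using ind by (simp add: linearly_independent_def)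
  have x: "x \<in> carrier M" using lincomb_carrier c B .
  let ?e = "\<lambda>b. c b + (-1) * d b"
  have "x \<oplus> (-1) \<odot> x = (1 + (-1)) \<odot> x"
    using smult_l_distr[of 1 "-1" x] smult_one[of x] x by simp
  also have "\<dots> = \<zero>" using smult_l_null[OF x] by simp
  finally have "lincomb M B ?e \<zero>"
    using lincomb_add[OF B c lincomb_smult[OF B d, of "-1"]] by simp
  then obtain A where A: "finite A" "A \<subseteq> B" "\<forall>b. b \<notin> A \<longrightarrow> ?e b = 0"
    "\<zero> = (\<Oplus>b\<in>A. ?e b \<odot> b)"
    unfolding lincomb_def by blast
  have "\<forall>b\<in>A. ?e b = \<zero>\<^bsub>\<Z>\<^esub>"
    using ind[unfolded linearly_independent_def, THEN conjunct2, rule_format, of A ?e] A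
    by simp
  with A(3) have "?e b = 0" by auto
  then show "c b = d b" by simp
qed

text \<open>
  The coordinate functions of a basis are functionals, because coefficients are unique, and an
  element with all coordinates zero is an empty sum.
\<close>

lemma free_imp_torsionless:
  assumes "free_module \<Z> M"
  shows "torsionless M"
  unfolding torsionless_def
proof (intro ballI impI)
  fix x assume x: "x \<in> carrier M" "x \<noteq> \<zero>"
  obtain B where ind: "linearly_independent \<Z> M B" and gen: "generates_module \<Z> M B"
    using assms by (auto simp: free_module_def)
  then have B: "B \<subseteq> carrier M" and ex: "\<And>y. y \<in> carrier M \<Longrightarrow> \<exists>c. lincomb M B c y"
    by (auto simp: generates_module_iff_lincomb)
  define coord where "coord y = (SOME c. lincomb M B c y)" for y
  have coord: "lincomb M B (coord y) y" if "y \<in> carrier M" for y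
    unfolding coord_def using ex[OF that] by (rule someI_ex)
  have coord_eq: "coord y = c" if "lincomb M B c y" for y c
    using lincomb_unique[OF ind coord[OF lincomb_carrier[OF that B]] that] .
  have "functional M (\<lambda>y. coord y b)" for b
    unfolding functional_def
    using coord_eq[OF lincomb_add[OF B coord coord]] coord_eq[OF lincomb_smult[OF B coord]]
    by simp
  moreover have "\<exists>b. coord x b \<noteq> 0"
  proof (rule ccontr)
    assume "\<nexists>b. coord x b \<noteq> 0"
    then have "coord x = (\<lambda>b. 0)" by auto
    then obtain A where "A \<subseteq> B" "x = (\<Oplus>b\<in>A. 0 \<odot> b)"
      using coord[OF x(1)] unfolding lincomb_def by auto
    moreover have "0 \<odot> b = \<zero>" if "b \<in> carrier M" for b
      using smult_l_null[OF that] by simp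
    ultimately have "x = \<zero>"
      using B by (auto intro!: M.add.finprod_one_eqI)
    with x show False by simp
  qed
  ultimately show "\<exists>f. functional M f \<and> f x \<noteq> 0" by blast
qed

end

section \<open>Double annihilators\<close>

definition double_annihilator :: "(int, 'a, 'm) module_scheme \<Rightarrow> 'a set \<Rightarrow> 'a set" where
  "double_annihilator M X =
     {x \<in> carrier M. \<forall>f. functional M f \<longrightarrow> (\<forall>y\<in>X. f y = 0) \<longrightarrow> f x = 0}"

lemma double_annihilator_mono:
  "X \<subseteq> Y \<Longrightarrow> double_annihilator M X \<subseteq> double_annihilator M Y"
  unfolding double_annihilator_def by blast

lemma double_annihilator_superset:
  "X \<subseteq> carrier M \<Longrightarrow> X \<subseteq> double_annihilator M X"
  unfolding double_annihilator_def by blast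

lemma double_annihilator_carrier: "x \<in> double_annihilator M X \<Longrightarrow> x \<in> carrier M"
  unfolding double_annihilator_def by blast

context int_module
begin

lemma double_annihilator_combination:
  assumes "x \<in> double_annihilator M X" "y \<in> double_annihilator M X"
  shows "x \<oplus> k \<odot> y \<in> double_annihilator M X"
  using assms smult_in_carrier
  by (auto simp: double_annihilator_def functional_add functional_smult)

lemma double_annihilator_zero: "\<zero> \<in> double_annihilator M X"
  using functional_zero by (auto simp: double_annihilator_def)

text \<open>
  Enlarging \<open>X\<close> by one element enlarges the double annihilator by at most one dimension: two
  functionals that vanish on \<open>X\<close> have a combination that vanishes at \<open>h\<close> as well.
\<close>

lemma functional_kernel_in_double_annihilator:
  assumes f: "functional M f" "\<forall>y\<in>X. f y = 0" "f h \<noteq> 0"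
    and x: "x \<in> double_annihilator M (insert h X)" "f x = 0"
  shows "x \<in> double_annihilator M X"
  unfolding double_annihilator_def
proof (intro CollectI conjI allI impI)
  show "x \<in> carrier M" using x(1) by (rule double_annihilator_carrier)
next
  fix g assume g: "functional M g" "\<forall>y\<in>X. g y = 0"
  let ?g = "\<lambda>y. f h * g y + (- g h) * f y"
  have "functional M ?g" using functional_combination[OF g(1) f(1)] .
  moreover have "\<forall>y\<in>insert h X. ?g y = 0" using f(2) g(2) by simp
  ultimately have "?g x = 0" using x(1) unfolding double_annihilator_def by blast
  then show "g x = 0" using x(2) f(3) by simp
qed

text \<open>
  The integers are a principal ideal domain: a nonzero value of least absolute value divides
  all others, since division with remainder can be carried out in the module.
\<close>

lemma functional_image_principal:
  assumes f: "functional M f"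
  shows "\<exists>b \<in> double_annihilator M X. \<forall>x \<in> double_annihilator M X. f b dvd f x"
proof (cases "\<exists>b \<in> double_annihilator M X. f b \<noteq> 0")
  case False
  then show ?thesis using double_annihilator_zero by auto
next
  case True
  let ?P = "\<lambda>b. b \<in> double_annihilator M X \<and> f b \<noteq> 0"
  obtain b where b: "?P b" and min: "\<And>y. ?P y \<Longrightarrow> nat \<bar>f b\<bar> \<le> nat \<bar>f y\<bar>"
    using True ex_has_least_nat[of ?P _ "\<lambda>y. nat \<bar>f y\<bar>"] by blast
  have "f b dvd f x" if x: "x \<in> double_annihilator M X" for x
  proof (rule ccontr)
    assume ndvd: "\<not> f b dvd f x"
    let ?r = "x \<oplus> (- (f x div f b)) \<odot> b"
    have r: "?r \<in> double_annihilator M X"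
      using double_annihilator_combination x b by blast
    have "f ?r = f x - (f x div f b) * f b"
      using functional_add[OF f, of x "(- (f x div f b)) \<odot> b"]
        functional_smult[OF f, of b "- (f x div f b)"] smult_in_carrier[of b]
        double_annihilator_carrier[of x M X] double_annihilator_carrier[of b M X] x b by simp
    then have fr: "f ?r = f x mod f b" by (simp add: minus_div_mult_eq_mod)
    then have "f ?r \<noteq> 0" using ndvd by (simp add: dvd_eq_mod_eq_0)
    then have "nat \<bar>f b\<bar> \<le> nat \<bar>f ?r\<bar>" using min r by blast
    then show False using abs_mod_less[of "f b" "f x"] b fr by simp
  qed
  then show ?thesis using b by blast
qed

text \<open>
  The step of the basis construction. It is uniform in \<open>h\<close>: if \<open>h\<close> already lies in the
  double annihilator of \<open>X\<close>, then \<open>f\<close> and \<open>b\<close> can be taken to be zero, and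
  divisibility by \<open>f b\<close> says that \<open>f x\<close> is zero.
\<close>

lemma double_annihilator_insert_step:
  "\<exists>f b. functional M f \<and> (\<forall>x\<in>double_annihilator M X. f x = 0) \<and>
     b \<in> double_annihilator M (insert h X) \<and>
     (\<forall>x\<in>double_annihilator M (insert h X).
        f b dvd f x \<and> (f x = 0 \<longrightarrow> x \<in> double_annihilator M X))"
proof (cases "\<exists>f. functional M f \<and> (\<forall>y\<in>X. f y = 0) \<and> f h \<noteq> 0")
  case True
  then obtain f where f: "functional M f" "\<forall>y\<in>X. f y = 0" "f h \<noteq> 0" by blast
  obtain b where "b \<in> double_annihilator M (insert h X)"
    "\<forall>x\<in>double_annihilator M (insert h X). f b dvd f x"
    using functional_image_principal[OF f(1)] by blast
  moreover have "\<forall>x\<in>double_annihilator M X. f x = 0"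
    using f unfolding double_annihilator_def by blast
  ultimately show ?thesis
    using f(1) functional_kernel_in_double_annihilator[OF f] by blast
next
  case False
  then have "double_annihilator M (insert h X) \<subseteq> double_annihilator M X"
    unfolding double_annihilator_def by blast
  moreover have "functional M (\<lambda>x. 0)" by (simp add: functional_def)
  ultimately show ?thesis
    using double_annihilator_zero by (intro exI[of _ "\<lambda>x. 0"] exI[of _ "\<zero>"]) auto
qed

section \<open>Bases from filtrations\<close>

text \<open>
  The conditions say that \<open>P (Suc n)\<close> is the direct sum of \<open>P n\<close> and the multiples of
  \<open>b n\<close> if \<open>f n (b n)\<close> is nonzero, and equals \<open>P n\<close> otherwise. The basis consists of the
  \<open>b n\<close> of the first kind. The matrix of the values \<open>f n (b m)\<close> is triangular, which gives
  independence; subtracting a multiple of \<open>b n\<close> moves an element of \<open>P (Suc n)\<close> into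
  \<open>P n\<close>, which gives generation.
\<close>

lemma free_if_cyclic_filtration:
  fixes P :: "nat \<Rightarrow> 'a set"
  assumes P0: "P 0 \<subseteq> {\<zero>}" and P_mono: "mono P" and P_Union: "(\<Union>n. P n) = carrier M"
    and P_closed: "\<And>n x y k. x \<in> P n \<Longrightarrow> y \<in> P n \<Longrightarrow> x \<oplus> k \<odot> y \<in> P n"
    and f: "\<And>n. functional M (f n)"
    and f_zero: "\<And>n x. x \<in> P n \<Longrightarrow> f n x = 0"
    and b: "\<And>n. b n \<in> P (Suc n)"
    and f_dvd: "\<And>n x. x \<in> P (Suc n) \<Longrightarrow> f n (b n) dvd f n x"
    and f_kernel: "\<And>n x. x \<in> P (Suc n) \<Longrightarrow> f n x = 0 \<Longrightarrow> x \<in> P n"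
  shows "free_module \<Z> M"
proof -
  define I where "I = {n. f n (b n) \<noteq> 0}"
  define B where "B = b ` I"
  have P_carrier: "x \<in> carrier M" if "x \<in> P n" for x n
    using that P_Union by blast
  have B_carrier: "B \<subseteq> carrier M" using b P_carrier by (auto simp: B_def)
  have earlier: "f n (b m) = 0" if "m < n" for m n
    using b[of m] f_zero[of "b m" n] monoD[OF P_mono, of "Suc m" n] that by auto
  have inj: "inj_on b I"
  proof (rule linorder_inj_onI)
    show "b m \<noteq> b n" if "m < n" "m \<in> I" "n \<in> I" for m n
      using earlier[OF that(1)] that(3) by (auto simp: I_def)
  qed auto
  have "linearly_independent \<Z> M B"
    unfolding linearly_independent_def
  proof (intro conjI allI impI ballI, rule B_carrier, elim conjE)
    fix A c a
    assume A: "finite A" "A \<subseteq> B" and sum0: "(\<Oplus>a\<in>A. c a \<odot> a) = \<zero>" and a: "a \<in> A"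
    define S where "S = {n \<in> I. b n \<in> A \<and> c (b n) \<noteq> 0}"
    have "inj_on b S" using inj by (rule inj_on_subset) (auto simp: S_def)
    then have S: "finite S"
      by (rule inj_on_finite[of b S A]) (use A in \<open>auto simp: S_def\<close>)
    show "c a = \<zero>\<^bsub>\<Z>\<^esub>"
    proof (rule ccontr)
      assume "c a \<noteq> \<zero>\<^bsub>\<Z>\<^esub>"
      then have "S \<noteq> {}" using a A by (auto simp: S_def B_def)
      \<comment> \<open>\<open>f n\<close> kills the basis elements before the last one that occurs in the relation.\<close>
      define n where "n = Max S"
      have n: "n \<in> S" and n_max: "\<And>m. m \<in> S \<Longrightarrow> m \<le> n"
        using S \<open>S \<noteq> {}\<close> by (auto simp: n_def)
      have others: "c x * f n x = 0" if x: "x \<in> A - {b n}" for x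
      proof -
        obtain m where m: "m \<in> I" "x = b m" using x A by (auto simp: B_def)
        have "m \<noteq> n" using x m by auto
        show ?thesis
        proof (cases "m < n")
          case True
          then show ?thesis using earlier m by simp
        next
          case False
          then have "m \<notin> S" using n_max \<open>m \<noteq> n\<close> by force
          then show ?thesis using m x by (auto simp: S_def)
        qed
      qed
      have "0 = (\<Sum>x\<in>A. c x * f n x)"
        using functional_finsum[OF f[of n] A(1), of c] functional_zero[OF f[of n]] sum0 A B_carrier
        by auto
      also have "\<dots> = c (b n) * f n (b n) + (\<Sum>x\<in>A - {b n}. c x * f n x)"
        using n A by (intro sum.remove) (auto simp: S_def)
      also have "(\<Sum>x\<in>A - {b n}. c x * f n x) = 0"
        using others by (intro sum.neutral) blast
      finally show False using n by (auto simp: S_def I_def)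
    qed
  qed
  moreover have "\<exists>c. lincomb M B c x" if "x \<in> P n" for n x
    using that
  proof (induction n arbitrary: x)
    case 0
    then show ?case using P0 lincomb_zero by blast
  next
    case (Suc n)
    show ?case
    proof (cases "n \<in> I")
      case False
      then have "x \<in> P n"
        using f_dvd[OF Suc.prems] f_kernel[OF Suc.prems] by (auto simp: I_def)
      then show ?thesis by (rule Suc.IH)
    next
      case True
      obtain k where k: "f n x = f n (b n) * k" using f_dvd[OF Suc.prems] by (auto elim: dvdE)
      have car: "x \<in> carrier M" "b n \<in> carrier M" using Suc.prems b P_carrier by blast+
      let ?x = "x \<oplus> (- k) \<odot> b n"
      have "f n ?x = 0"
        using functional_add[OF f car(1) smult_in_carrier[OF car(2)]]
          functional_smult[OF f car(2)] k by simp
      then have "?x \<in> P n" using f_kernel P_closed Suc.prems b by blast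
      then obtain c where c: "lincomb M B c ?x" using Suc.IH by blast
      obtain d where d: "lincomb M B d (k \<odot> b n)"
        using lincomb_smult[OF B_carrier lincomb_basis_element] True car(2)
        by (auto simp: B_def)
      have "(- k) \<odot> b n \<oplus> k \<odot> b n = \<zero>"
        using smult_l_distr[of "-k" k "b n"] smult_l_null[OF car(2)] car by simp
      then have "?x \<oplus> k \<odot> b n = x"
        using car smult_in_carrier by (simp add: M.a_assoc)
      then show ?thesis using lincomb_add[OF B_carrier c d] by auto
    qed
  qed
  then have "generates_module \<Z> M B"
    unfolding generates_module_iff_lincomb using B_carrier P_Union by blast
  ultimately show ?thesis
    unfolding free_module_def using module_axioms by blast
qed

text \<open>
  The filtration consists of the double annihilators of the initial segments of an enumeration.
  It starts at zero because the module is torsionless.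
\<close>

theorem countable_torsionless_imp_free:
  assumes "countable (carrier M)" "torsionless M"
  shows "free_module \<Z> M"
proof -
  define h where "h = from_nat_into (carrier M)"
  have h: "range h = carrier M"
    unfolding h_def using assms(1) M.zero_closed by (intro range_from_nat_into) auto
  define P where "P n = double_annihilator M (h ` {..<n})" for n
  have P_Suc: "P (Suc n) = double_annihilator M (insert (h n) (h ` {..<n}))" for n
    by (simp add: P_def lessThan_Suc)
  have "\<forall>n. \<exists>f b. functional M f \<and> (\<forall>x\<in>P n. f x = 0) \<and> b \<in> P (Suc n) \<and>
     (\<forall>x\<in>P (Suc n). f b dvd f x \<and> (f x = 0 \<longrightarrow> x \<in> P n))"
    unfolding P_Suc unfolding P_def using double_annihilator_insert_step by blast
  then obtain f b where fb: "\<And>n. functional M (f n) \<and> (\<forall>x\<in>P n. f n x = 0) \<and>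
     b n \<in> P (Suc n) \<and> (\<forall>x\<in>P (Suc n). f n (b n) dvd f n x \<and> (f n x = 0 \<longrightarrow> x \<in> P n))"
    by metis
  show ?thesis
  proof (rule free_if_cyclic_filtration[of P f b])
    show "P 0 \<subseteq> {\<zero>}"
      using assms(2) by (auto simp: P_def double_annihilator_def torsionless_def)
    show "mono P"
      unfolding P_def by (intro monoI double_annihilator_mono image_mono) auto
    have "h n \<in> P (Suc n)" for n
      unfolding P_def using double_annihilator_superset[of "h ` {..<Suc n}" M] h by auto
    then have "range h \<subseteq> (\<Union>n. P n)" by (intro image_subsetI UN_I[OF UNIV_I])
    moreover have "P n \<subseteq> carrier M" for n
      unfolding P_def by (rule subsetI) (rule double_annihilator_carrier)
    ultimately show "(\<Union>n. P n) = carrier M"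
      unfolding h by (intro equalityI UN_least)
    show "x \<oplus> k \<odot> y \<in> P n" if "x \<in> P n" "y \<in> P n" for n x y k
      using that unfolding P_def by (rule double_annihilator_combination)
  qed (use fb in blast)+
qed

end

section \<open>Products\<close>

lemma product_module_is_module:
  assumes R: "cring R" and N: "\<And>i. i \<in> I \<Longrightarrow> module R (N i)"
  shows "module R (product_module I N)"
proof -
  have ab: "abelian_group (N i)" if "i \<in> I" for i using N[OF that] by (simp add: module_def)
  note cl = abelian_group.axioms(1)[OF ab]
  show ?thesis
  proof (rule moduleI[OF R])
    show "abelian_group (product_module I N)"
    proof (rule abelian_groupI)
      fix x assume x: "x \<in> carrier (product_module I N)"
      have "(\<lambda>i\<in>I. \<ominus>\<^bsub>N i\<^esub> x i) \<in> carrier (product_module I N)"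
        using x by (auto simp: product_module_def PiE_iff ab abelian_group.a_inv_closed)
      moreover have "(\<lambda>i\<in>I. \<ominus>\<^bsub>N i\<^esub> x i) \<oplus>\<^bsub>product_module I N\<^esub> x = \<zero>\<^bsub>product_module I N\<^esub>"
        using x by (auto simp: product_module_def PiE_iff ab abelian_group.l_neg
            intro!: restrict_ext)
      ultimately show "\<exists>y\<in>carrier (product_module I N). y \<oplus>\<^bsub>product_module I N\<^esub> x = \<zero>\<^bsub>product_module I N\<^esub>"
        by blast
    next
      fix x assume "x \<in> carrier (product_module I N)"
      then show "\<zero>\<^bsub>product_module I N\<^esub> \<oplus>\<^bsub>product_module I N\<^esub> x = x"
        by (auto simp: product_module_def PiE_iff cl abelian_monoid.l_zero extensional_def fun_eq_iff)
    qed (auto simp: product_module_def PiE_iff cl abelian_monoid.a_closed abelian_monoid.zero_closed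
        abelian_monoid.a_assoc abelian_monoid.a_comm abelian_monoid.a_lcomm intro!: restrict_ext)
  qed (auto simp: product_module_def PiE_iff module.smult_closed[OF N] module.smult_l_distr[OF N]
      module.smult_r_distr[OF N] module.smult_assoc1[OF N] module.smult_one[OF N] extensional_def fun_eq_iff)
qed

text \<open>
  Negatives and zero are scalar multiples, so closure under addition and scalars suffices.
\<close>

lemma submodule_projection:
  assumes N: "module R (N i)" and P: "module R (product_module I N)" and i: "i \<in> I"
    and H: "submodule H R (product_module I N)"
  shows "submodule ((\<lambda>x. x i) ` H) R (N i)"
proof (rule module.submoduleI[OF N])
  note E = module.submoduleE[OF P H]
  interpret N: module R "N i" by (rule N)
  have car: "x i \<in> carrier (N i)" if "x \<in> H" for x
    using that E(1) i by (auto simp: product_module_def)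
  then show "(\<lambda>x. x i) ` H \<subseteq> carrier (N i)" by blast
  show add: "a \<oplus>\<^bsub>N i\<^esub> b \<in> (\<lambda>x. x i) ` H" if ab: "a \<in> (\<lambda>x. x i) ` H" "b \<in> (\<lambda>x. x i) ` H" for a b
  proof -
    obtain x y where xy: "x \<in> H" "y \<in> H" "a = x i" "b = y i" using ab by blast
    then have "a \<oplus>\<^bsub>N i\<^esub> b = (x \<oplus>\<^bsub>product_module I N\<^esub> y) i"
      using i by (simp add: product_module_def)
    then show ?thesis using E(5) xy by blast
  qed
  show smult: "r \<odot>\<^bsub>N i\<^esub> a \<in> (\<lambda>x. x i) ` H" if ra: "r \<in> carrier R" "a \<in> (\<lambda>x. x i) ` H" for r a
  proof -
    obtain x where x: "x \<in> H" "a = x i" using ra by blast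
    then have "r \<odot>\<^bsub>N i\<^esub> a = (r \<odot>\<^bsub>product_module I N\<^esub> x) i"
      using i by (simp add: product_module_def)
    then show ?thesis using E(4) x ra by blast
  qed
  show neg: "\<ominus>\<^bsub>N i\<^esub> a \<in> (\<lambda>x. x i) ` H" if "a \<in> (\<lambda>x. x i) ` H" for a
  proof -
    have a: "a \<in> carrier (N i)" using that car by blast
    have "\<ominus>\<^bsub>N i\<^esub> a = (\<ominus>\<^bsub>R\<^esub> \<one>\<^bsub>R\<^esub>) \<odot>\<^bsub>N i\<^esub> a"
      using a by (simp add: N.smult_l_minus)
    then show ?thesis using smult[OF _ that] by simp
  qed
  obtain x where "x \<in> H" using E(2) by blast
  then show "\<zero>\<^bsub>N i\<^esub> \<in> (\<lambda>x. x i) ` H"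
    using smult[OF N.R.zero_closed, of "x i"] car by simp
qed

theorem corollaryA4:
  fixes N :: "nat \<Rightarrow> (int, 'a, 'm) module_scheme"
  assumes "\<And>k. k \<ge> 1 \<Longrightarrow> nearly_free (N k)"
  shows "nearly_free (product_module {1..} N)"
proof -
  let ?P = "product_module {1..} N"
  have N: "module \<Z> (N k)" if "k \<in> {1..}" for k
    using assms that by (simp add: nearly_free_def)
  have P: "module \<Z> ?P" using product_module_is_module[OF int_is_cring N] .
  have "free_module \<Z> (?P\<lparr>carrier := H\<rparr>)" if H: "submodule H \<Z> ?P" "countable H" for H
  proof -
    let ?M = "?P\<lparr>carrier := H\<rparr>"
    interpret M: int_module ?M
      unfolding int_module_def using submodule.submodule_is_module[OF H(1) P] .
    have "torsionless ?M"
      unfolding torsionless_def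
    proof (intro ballI impI)
      fix x assume "x \<in> carrier ?M" "x \<noteq> \<zero>\<^bsub>?M\<^esub>"
      then have x: "x \<in> H" "x \<noteq> (\<lambda>k\<in>{1..}. \<zero>\<^bsub>N k\<^esub>)" by (auto simp: product_module_def)
      have "x \<in> extensional {1..}"
        using x module.submoduleE(1)[OF P H(1)] by (auto simp: product_module_def PiE_iff)
      then obtain k where k: "k \<in> {1..}" "x k \<noteq> \<zero>\<^bsub>N k\<^esub>"
        using x(2) extensionalityI[OF _ restrict_extensional, of x "{1..}" "\<lambda>k. \<zero>\<^bsub>N k\<^esub>"]
        by auto
      let ?K = "(\<lambda>y. y k) ` H"
      have sub: "submodule ?K \<Z> (N k)" using submodule_projection[OF N[OF k(1)] P k(1) H(1)] .
      interpret K: int_module "N k\<lparr>carrier := ?K\<rparr>"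
        unfolding int_module_def using submodule.submodule_is_module[OF sub N[OF k(1)]] .
      have "free_module \<Z> (N k\<lparr>carrier := ?K\<rparr>)"
        using assms[of k] k(1) sub H(2) by (auto simp: nearly_free_def)
      then obtain f where f: "functional (N k\<lparr>carrier := ?K\<rparr>) f" "f (x k) \<noteq> 0"
        using K.free_imp_torsionless x(1) k(2) by (auto simp: torsionless_def)
      have "functional ?M (\<lambda>y. f (y k))"
        using f(1) k(1) by (auto simp: functional_def product_module_def)
      with f(2) show "\<exists>f. functional ?M f \<and> f x \<noteq> 0" by blast
    qed
    then show ?thesis using M.countable_torsionless_imp_free H(2) by simp
  qed
  then show ?thesis using P by (simp add: nearly_free_def)
qed

end
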